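(* Suppose the weak $3x+1$ conjecture holds. Then the wild integer semigroup $\mathcal{W}(\mathbb{Z})$ is a free commutative semigroup whose set of (irreducible) generators consists entirely of prime numbers. In other words, every wild number is a prime number.
   Context: For integers $n\ge 0$ let $g(n)=\frac{3n+2}{2n+1}$. The wild semigroup $\mathcal{W}$ is the multiplicative semigroup of positive rationals generated by $\{g(n): n\ge 0\}$ together with $\frac12$ (all finite products, repetitions allowed). The wild integer semigroup is $\mathcal{W}(\mathbb{Z})=\mathcal{W}\cap\mathbb{Z}$, a commutative semigroup with unit $1$. An irreducible element of a commutative semigroup is one that cannot be written as a product of two nonunits; the wild numbers are the irreducible elements of $\mathcal{W}(\mathbb{Z})$. A commutative semigroup (with unit $1$) is free if every element other than $1$ factors uniquely, up to order, as a product of irreducible elements. The weak $3x+1$ conjecture is the assertion that the semigroup $\mathcal{W}^{-1}=\{w^{-1}: w\in\mathcal{W}\}$ (which is generated by $\{\frac{2n+1}{3n+2}: n\ge 0\}$ together with $2$) contains every positive integer. *)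

theory Defs
  imports Complex_Main "HOL-Algebra.Group" "HOL-Computational_Algebra.Primes"
begin

definition wild_g :: "nat \<Rightarrow> rat" where
  "wild_g n = (3 * of_nat n + 2) / (2 * of_nat n + 1)"

(* Only nonempty products are generated; nevertheless 1 is an element, since 1 = g(0) * (1/2). *)
inductive_set wild_semigroup :: "rat set" where
  gen: "wild_g n \<in> wild_semigroup"
| half: "1 / 2 \<in> wild_semigroup"
| mult: "\<lbrakk>x \<in> wild_semigroup; y \<in> wild_semigroup\<rbrakk> \<Longrightarrow> x * y \<in> wild_semigroup"

definition wild_integer_semigroup :: "int monoid" where
  "wild_integer_semigroup =
     \<lparr>carrier = {k. rat_of_int k \<in> wild_semigroup}, monoid.mult = (*), one = 1\<rparr>"

(* Units themselves are excluded, by the usual convention: otherwise 1 would be an irreducible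
   element of every semigroup without nontrivial units. *)
definition irreducibles :: "('a, 'b) monoid_scheme \<Rightarrow> 'a set" where
  "irreducibles G =
     {a \<in> carrier G. a \<notin> Units G \<and>
        \<not> (\<exists>b \<in> carrier G - Units G. \<exists>c \<in> carrier G - Units G. a = b \<otimes>\<^bsub>G\<^esub> c)}"

definition irreducible_factorization ::
    "('a, 'b) monoid_scheme \<Rightarrow> 'a list \<Rightarrow> 'a \<Rightarrow> bool" where
  "irreducible_factorization G fs a \<longleftrightarrow>
     set fs \<subseteq> irreducibles G \<and> foldr (\<otimes>\<^bsub>G\<^esub>) fs \<one>\<^bsub>G\<^esub> = a"

definition free_commutative_semigroup :: "('a, 'b) monoid_scheme \<Rightarrow> bool" where
  "free_commutative_semigroup G \<longleftrightarrow>
     comm_monoid G \<and>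
     (\<forall>a \<in> carrier G. a \<noteq> \<one>\<^bsub>G\<^esub> \<longrightarrow>
        (\<exists>fs. irreducible_factorization G fs a) \<and>
        (\<forall>fs fs'. irreducible_factorization G fs a \<longrightarrow> irreducible_factorization G fs' a
                    \<longrightarrow> mset fs = mset fs'))"

definition wild_numbers :: "int set" where
  "wild_numbers = irreducibles wild_integer_semigroup"

definition weak_3x_plus_1_conjecture :: bool where
  "weak_3x_plus_1_conjecture \<longleftrightarrow>
     (\<forall>m::nat. m > 0 \<longrightarrow> rat_of_nat m \<in> inverse ` wild_semigroup)"

end

theory Submission
  imports Defs
begin

text \<open>
  Under the weak conjecture every \<open>1 / m\<close> lies in the wild semigroup, so multiplying a wild integer
  by \<open>1 / m\<close> shows that the wild integers are closed under taking positive divisors. Hence the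
  irreducible wild integers are exactly the primes that are wild, and unique factorization is
  inherited from the integers.
\<close>

lemma wild_semigroup_pos: "x \<in> wild_semigroup \<Longrightarrow> x > 0"
proof (induction rule: wild_semigroup.induct)
  case (gen n)
  have "(0::rat) < 3 * of_nat n + 2" "(0::rat) < 2 * of_nat n + 1"
    by (simp_all add: add_nonneg_pos)
  then show ?case
    by (simp add: wild_g_def)
qed simp_all

lemma one_in_wild_semigroup: "1 \<in> wild_semigroup"
  using wild_semigroup.mult[OF wild_semigroup.gen[of 0] wild_semigroup.half]
  by (simp add: wild_g_def)

lemma carrier_wild_integer [simp]:
  "k \<in> carrier wild_integer_semigroup \<longleftrightarrow> rat_of_int k \<in> wild_semigroup"
  by (simp add: wild_integer_semigroup_def)

lemma mult_wild_integer [simp]: "x \<otimes>\<^bsub>wild_integer_semigroup\<^esub> y = x * y"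
  by (simp add: wild_integer_semigroup_def)

lemma one_wild_integer [simp]: "\<one>\<^bsub>wild_integer_semigroup\<^esub> = 1"
  by (simp add: wild_integer_semigroup_def)

lemma wild_integer_pos: "k \<in> carrier wild_integer_semigroup \<Longrightarrow> k > 0"
  using wild_semigroup_pos by fastforce

lemma comm_monoid_wild_integer: "comm_monoid wild_integer_semigroup"
  by unfold_locales
    (auto simp: one_in_wild_semigroup wild_semigroup.mult Units_def algebra_simps)

text \<open>The only integers with an integer inverse are 1 and -1, and positivity rules out -1. So
  in \<open>irreducibles\<close> a nonunit is simply an element other than 1.\<close>

lemma Units_wild_integer: "Units wild_integer_semigroup = {1}"
proof -
  have "x = 1" if "x \<in> Units wild_integer_semigroup" for x
  proof -
    from that obtain y where "x \<in> carrier wild_integer_semigroup" "y * x = 1"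
      by (auto simp: Units_def)
    then show ?thesis
      using wild_integer_pos[of x] by (auto simp: zmult_eq_1_iff)
  qed
  moreover have "1 \<in> Units wild_integer_semigroup"
    by (auto simp: Units_def one_in_wild_semigroup)
  ultimately show ?thesis
    by blast
qed

text \<open>The weak conjecture enters the argument only here. Since it supplies the inverse of
  every positive integer \<open>b\<close>, any positive cofactor can be cancelled inside the
  semigroup.\<close>

lemma wild_integer_divisor_closed:
  assumes "weak_3x_plus_1_conjecture"
    and "a * b \<in> carrier wild_integer_semigroup" and "b > 0"
  shows "a \<in> carrier wild_integer_semigroup"
proof -
  have "rat_of_nat (nat b) \<in> inverse ` wild_semigroup"
    using assms(1) \<open>b > 0\<close> unfolding weak_3x_plus_1_conjecture_def by (metis zero_less_nat_eq)
  then have "inverse (rat_of_int b) \<in> wild_semigroup"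
    using \<open>b > 0\<close> by (auto simp: of_nat_nat)
  with assms(2) have "rat_of_int (a * b) * inverse (rat_of_int b) \<in> wild_semigroup"
    by (intro wild_semigroup.mult) simp_all
  then show ?thesis
    using \<open>b > 0\<close> by (simp add: mult.assoc)
qed

lemma wild_numbers_eq:
  assumes "weak_3x_plus_1_conjecture"
  shows "wild_numbers = {p \<in> carrier wild_integer_semigroup. prime p}"
proof (intro Set.set_eqI iffI)
  fix p assume p: "p \<in> wild_numbers"
  then have wild: "p \<in> carrier wild_integer_semigroup" and "p \<noteq> 1"
    and irred: "\<And>b c. b \<in> carrier wild_integer_semigroup \<Longrightarrow> c \<in> carrier wild_integer_semigroup
      \<Longrightarrow> p = b * c \<Longrightarrow> b = 1 \<or> c = 1"
    unfolding wild_numbers_def irreducibles_def Units_wild_integer mult_wild_integer by blast+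
  have "p > 1"
    using wild_integer_pos[OF wild] \<open>p \<noteq> 1\<close> by simp
  \<comment> \<open>\<open>prime_int_iff\<close> tests primality on nonnegative divisors.\<close>
  moreover have "b = 1 \<or> b = p" if "b \<ge> 0" "b dvd p" for b
  proof -
    from that obtain c where c: "p = b * c" by blast
    have "b * c > 0"
      using c \<open>p > 1\<close> by simp
    then have "b > 0" "c > 0"
      using that(1) by (auto simp: zero_less_mult_iff)
    then show ?thesis
      \<comment> \<open>Divisor closure is applied twice, with the roles of \<open>b\<close> and
        \<open>c\<close> exchanged, so that both factors are wild and irreducibility of
        \<open>p\<close> applies. If \<open>c = 1\<close>, then \<open>b = p\<close>.\<close>
      using irred[of b c] wild c wild_integer_divisor_closed[OF assms, of b c]
        wild_integer_divisor_closed[OF assms, of c b] by (auto simp: mult.commute)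
  qed
  ultimately show "p \<in> {p \<in> carrier wild_integer_semigroup. prime p}"
    using wild by (simp add: prime_int_iff)
next
  fix p assume "p \<in> {p \<in> carrier wild_integer_semigroup. prime p}"
  then have wild: "p \<in> carrier wild_integer_semigroup" and "prime p"
    by auto
  have "b = 1 \<or> c = 1"
    if "b \<in> carrier wild_integer_semigroup" "c \<in> carrier wild_integer_semigroup" "p = b * c" for b c
  proof -
    have "b > 0"
      by (rule wild_integer_pos[OF that(1)])
    \<comment> \<open>In the case \<open>b = p\<close>, cancelling the nonzero \<open>b\<close> in
      \<open>p = b * c\<close> leaves \<open>c = 1\<close>.\<close>
    then have "b = 1 \<or> b = p"
      using \<open>prime p\<close> that(3) unfolding prime_int_iff by (metis dvd_triv_left less_imp_le)
    then show ?thesis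
      using that(3) \<open>b > 0\<close> by auto
  qed
  moreover have "p \<noteq> 1"
    using \<open>prime p\<close> by auto
  ultimately show "p \<in> wild_numbers"
    using wild
    unfolding wild_numbers_def irreducibles_def Units_wild_integer mult_wild_integer by blast
qed

lemma irreducible_factorization_wild_integer:
  "irreducible_factorization wild_integer_semigroup fs a \<longleftrightarrow>
     set fs \<subseteq> wild_numbers \<and> prod_list fs = a"
proof -
  \<comment> \<open>Inside \<open>foldr\<close> the operation occurs without arguments, where the
    pointwise rule \<open>mult_wild_integer\<close> cannot rewrite it.\<close>
  have "monoid.mult wild_integer_semigroup = (*)"
    by (simp add: wild_integer_semigroup_def)
  then show ?thesis
    by (simp add: irreducible_factorization_def wild_numbers_def prod_list.eq_foldr)
qed

theorem theorem3p2:
  assumes "weak_3x_plus_1_conjecture"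
  shows "free_commutative_semigroup wild_integer_semigroup \<and> (\<forall>p \<in> wild_numbers. prime p)"
proof -
  have wild_numbers: "wild_numbers = {p \<in> carrier wild_integer_semigroup. prime p}"
    by (rule wild_numbers_eq[OF assms])
  have existence: "\<exists>fs. irreducible_factorization wild_integer_semigroup fs a"
    if a: "a \<in> carrier wild_integer_semigroup" for a
  proof -
    have "a > 0" by (rule wild_integer_pos[OF a])
    \<comment> \<open>Any listing of the prime factors of \<open>a\<close> over the integers will
      serve; what remains is that each of them is wild.\<close>
    obtain fs where fs: "mset fs = prime_factorization a"
      using ex_mset by blast
    have "p \<in> wild_numbers" if "p \<in> set fs" for p
    proof -
      have "p \<in># prime_factorization a"
        using that fs by (metis set_mset_mset)
      then have "prime p" "p dvd a" by auto
      then obtain c where c: "a = p * c" by blast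
      have "c > 0"
        using c \<open>a > 0\<close> prime_gt_0_int[OF \<open>prime p\<close>] by (simp add: zero_less_mult_iff)
      then show ?thesis
        using wild_integer_divisor_closed[OF assms, of p c] a c \<open>prime p\<close>
        by (simp add: wild_numbers)
    qed
    \<comment> \<open>Positivity of \<open>a\<close> matters: the prime factors of a negative
      integer multiply only to its absolute value.\<close>
    moreover have "prod_list fs = a"
      using \<open>a > 0\<close> fs prod_mset_prime_factorization_int[of a] by (metis prod_mset_prod_list)
    ultimately show ?thesis
      unfolding irreducible_factorization_wild_integer by blast
  qed
  \<comment> \<open>The right-hand side does not mention \<open>fs\<close>, so any two
    factorizations of \<open>a\<close> have the same multiset of factors.\<close>
  have uniqueness: "mset fs = prime_factorization a"
    if "irreducible_factorization wild_integer_semigroup fs a" for fs a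
  proof -
    have "prime_factorization (prod_mset (mset fs)) = mset fs"
      using that by (intro prime_factorization_prod_mset_primes)
        (auto simp: irreducible_factorization_wild_integer wild_numbers)
    then show ?thesis
      using that by (simp add: irreducible_factorization_wild_integer prod_mset_prod_list)
  qed
  show ?thesis
    using comm_monoid_wild_integer existence uniqueness wild_numbers
    by (auto simp: free_commutative_semigroup_def)
qed

end
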